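(* Let $V=\langle f_1,\dots,f_{n+1}\rangle$ be an $(n+1)$-dimensional graded thread $W^+$-module such that $e_nf_1\ne0$, and let $\alpha_1,\dots,\alpha_n\in\mathbb K$ be the constants defined by $e_1f_i=\alpha_if_{i+1}$, $i=1,\dots,n$. Then one of the following three possibilities holds: a) no zeroes: $\alpha_i\neq0$ for all $i=1,\dots,n$; b) exactly one zero: there is exactly one $k$, $1\le k\le n$, with $\alpha_k=0$; c) two neighboring zeroes: there is $k$, $1\le k\le n-1$, such that $\alpha_k=\alpha_{k+1}=0$ and $\alpha_i\ne0$ for all $i\neq k,k+1$.
   Context: $\mathbb K$ is $\mathbb R$ or $\mathbb C$. $W^+$ is the Lie algebra over $\mathbb K$ with basis $e_1,e_2,e_3,\dots$ and bracket $[e_i,e_j]=(j-i)e_{i+j}$. An $(n+1)$-dimensional graded thread $W^+$-module is a $W^+$-module $V$ with a basis $f_1,\dots,f_{n+1}$ such that $e_if_j\in\langle f_{i+j}\rangle$ for all $i\ge1$, with $f_m=0$ for $m>n+1$. *)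

theory Defs
  imports Complex_Main "HOL-Computational_Algebra.Polynomial"
begin

text \<open>
  The ground field is \<open>\<real>\<close> or \<open>\<complex>\<close>, up to isomorphism of fields.
\<close>

class real_or_complex = field +
  assumes real_or_complex:
    "(\<exists>\<phi> :: 'a \<Rightarrow> real. bij \<phi> \<and> (\<forall>x y. \<phi> (x + y) = \<phi> x + \<phi> y) \<and> (\<forall>x y. \<phi> (x * y) = \<phi> x * \<phi> y))
   \<or> (\<exists>\<phi> :: 'a \<Rightarrow> complex. bij \<phi> \<and> (\<forall>x y. \<phi> (x + y) = \<phi> x + \<phi> y) \<and> (\<forall>x y. \<phi> (x * y) = \<phi> x * \<phi> y))"

instance real :: real_or_complex
  by standard (intro disjI1 exI[of _ id], simp)

instance complex :: real_or_complex
  by standard (intro disjI2 exI[of _ id], simp)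

locale lie_algebra = vector_space scale
  for scale :: "'k::field \<Rightarrow> 'g::ab_group_add \<Rightarrow> 'g" +
  fixes bracket :: "'g \<Rightarrow> 'g \<Rightarrow> 'g"
  assumes bracket_linear_left: "Vector_Spaces.linear scale scale (\<lambda>x. bracket x y)"
    and bracket_linear_right: "Vector_Spaces.linear scale scale (\<lambda>y. bracket x y)"
    and bracket_alternating: "bracket x x = 0"
    and bracket_jacobi:
      "bracket x (bracket y z) + bracket y (bracket z x) + bracket z (bracket x y) = 0"

locale lie_module = lie_algebra scale bracket + V: vector_space scaleV
  for scale :: "'k::field \<Rightarrow> 'g::ab_group_add \<Rightarrow> 'g"
    and bracket :: "'g \<Rightarrow> 'g \<Rightarrow> 'g"
    and scaleV :: "'k \<Rightarrow> 'v::ab_group_add \<Rightarrow> 'v" +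
  fixes act :: "'g \<Rightarrow> 'v \<Rightarrow> 'v"
  assumes act_linear_left: "Vector_Spaces.linear scale scaleV (\<lambda>x. act x v)"
    and act_linear_right: "Vector_Spaces.linear scaleV scaleV (\<lambda>v. act x v)"
    and act_bracket: "act (bracket x y) v = act x (act y v) - act y (act x v)"

text \<open>
  \<open>W\<^sup>+\<close> is given by its basis and structure constants, which determine it up to
  isomorphism; the value \<open>e 0\<close> is unconstrained. A realization is given in
  \<open>W_plus_polynomial_vector_fields\<close> below.
\<close>

locale W_plus = lie_algebra scale bracket
  for scale :: "'k::field \<Rightarrow> 'g::ab_group_add \<Rightarrow> 'g"
    and bracket :: "'g \<Rightarrow> 'g \<Rightarrow> 'g" +
  fixes e :: "nat \<Rightarrow> 'g"
  assumes e_inj: "inj_on e {1..}"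
    and e_independent: "independent (e ` {1..})"
    and e_span: "span (e ` {1..}) = UNIV"
    and bracket_e: "i \<ge> 1 \<Longrightarrow> j \<ge> 1 \<Longrightarrow>
      bracket (e i) (e j) = scale (of_int (int j - int i)) (e (i + j))"

text \<open>The basis of the module is \<open>f 1, \<dots>, f (n + 1)\<close>; the value \<open>f 0\<close> is unconstrained.\<close>

locale graded_thread_module =
  W_plus scale bracket e + lie_module scale bracket scaleV act
  for scale :: "'k::field \<Rightarrow> 'g::ab_group_add \<Rightarrow> 'g"
    and bracket :: "'g \<Rightarrow> 'g \<Rightarrow> 'g"
    and e :: "nat \<Rightarrow> 'g"
    and scaleV :: "'k \<Rightarrow> 'v::ab_group_add \<Rightarrow> 'v"
    and act :: "'g \<Rightarrow> 'v \<Rightarrow> 'v" +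
  fixes n :: nat and f :: "nat \<Rightarrow> 'v"
  assumes f_inj: "inj_on f {1..n + 1}"
    and f_independent: "V.independent (f ` {1..n + 1})"
    and f_span: "V.span (f ` {1..n + 1}) = UNIV"
    and f_zero: "m > n + 1 \<Longrightarrow> f m = 0"
    and e_f: "i \<ge> 1 \<Longrightarrow> 1 \<le> j \<Longrightarrow> j \<le> n + 1 \<Longrightarrow> act (e i) (f j) \<in> V.span {f (i + j)}"

text \<open>
  \<open>W\<^sup>+\<close> as the polynomial vector fields \<open>x\<^sup>2 q(x) d/dx\<close>, with \<open>e\<^sub>i = x\<^bsup>i+1\<^esup> d/dx\<close>;
  the vector field is represented by the polynomial \<open>q\<close>.
\<close>

lemma W_plus_polynomial_vector_fields:
  "W_plus (smult :: 'k::field \<Rightarrow> 'k poly \<Rightarrow> 'k poly)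
     (\<lambda>q s. monom 1 2 * (q * pderiv s - s * pderiv q)) (\<lambda>i. monom 1 (i - 1))"
proof -
  interpret P: vector_space "smult :: 'k \<Rightarrow> 'k poly \<Rightarrow> 'k poly"
    by standard (simp_all add: smult_add_left smult_add_right)
  let ?e = "\<lambda>i. monom (1::'k) (i - 1)"
  have img: "?e ` {1..} = range (monom (1::'k))"
  proof
    show "range (monom (1::'k)) \<subseteq> ?e ` {1..}"
      by (auto intro!: image_eqI[where x = "Suc _"])
  qed auto
  have monom_eq: "monom c k = smult c (monom 1 k)" for c :: 'k and k
    by (simp add: smult_monom)
  show ?thesis
  proof unfold_locales
    show "inj_on ?e {1..}"
      by (auto simp: inj_on_def monom_eq_iff')
    show "P.independent (?e ` {1..})"
      unfolding img P.independent_explicit_module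
    proof (intro allI impI)
      fix t :: "'k poly set" and u v
      assume t: "finite t" "t \<subseteq> range (monom 1)" and s: "(\<Sum>v\<in>t. smult (u v) v) = 0" and "v \<in> t"
      then obtain k where k: "v = monom 1 k" by auto
      have "0 = coeff (\<Sum>v\<in>t. smult (u v) v) k" using s by simp
      also have "\<dots> = (\<Sum>w\<in>t. u w * coeff w k)" by (simp add: coeff_sum)
      also have "\<dots> = (\<Sum>w\<in>t. if w = v then u v else 0)"
        using t(2) k by (intro sum.cong) (auto simp: coeff_monom dest!: subsetD split: if_splits)
      also have "\<dots> = u v" using t \<open>v \<in> t\<close> by simp
      finally show "u v = 0" by simp
    qed
    show "P.span (?e ` {1..}) = UNIV"
    proof -
      have "p \<in> P.span (range (monom 1))" for p :: "'k poly"
      proof -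
        have "(\<Sum>i\<le>degree p. monom (coeff p i) i) \<in> P.span (range (monom 1))"
          by (subst monom_eq) (intro P.span_sum P.span_scale P.span_base, simp)
        then show ?thesis by (simp add: poly_as_sum_of_monoms)
      qed
      then show ?thesis unfolding img by auto
    qed
    fix i j :: nat assume "i \<ge> 1" "j \<ge> 1"
    then obtain a b where "i = Suc a" "j = Suc b" by (metis Suc_le_D One_nat_def)
    then show "monom 1 2 * (?e i * pderiv (?e j) - ?e j * pderiv (?e i))
        = smult (of_int (int j - int i)) (?e (i + j))"
      by (cases a; cases b)
         (simp_all add: pderiv_monom mult_monom smult_monom algebra_simps
            flip: diff_monom add_monom minus_monom)
  qed (simp_all add: algebra_simps pderiv_add pderiv_diff pderiv_mult pderiv_smult smult_diff_right)
qed

end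

theory Submission
  imports Defs
begin

text \<open>
  Let \<open>n \<ge> 2\<close>. Since \<open>(k - 1) e\<^bsub>k+1\<^esub> = [e\<^sub>1, e\<^sub>k]\<close>, in characteristic zero the operator \<open>e\<^sub>n\<close> is a
  linear combination of the words \<open>e\<^sub>1\<^sup>a e\<^sub>2 e\<^sub>1\<^sup>b\<close> with \<open>a + b = n - 2\<close>. Applied to \<open>f\<^sub>1\<close>, such a word
  picks up every \<open>\<alpha>\<^sub>i\<close> except \<open>\<alpha>\<^bsub>b+1\<^esub>\<close> and \<open>\<alpha>\<^bsub>b+2\<^esub>\<close>. So if \<open>e\<^sub>n f\<^sub>1 \<noteq> 0\<close>, then for some \<open>b\<close> all
  zeros lie in \<open>{b + 1, b + 2}\<close>.
\<close>

lemma CHAR_eq_if_inj_ring_hom: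
  fixes \<phi> :: "'a::semiring_1 \<Rightarrow> 'b::idom"
  assumes inj: "inj \<phi>"
    and add: "\<And>x y. \<phi> (x + y) = \<phi> x + \<phi> y"
    and mult: "\<And>x y. \<phi> (x * y) = \<phi> x * \<phi> y"
  shows "CHAR('a) = CHAR('b)"
proof -
  have zero: "\<phi> 0 = 0"
    using add[of 0 0] by (simp only: add_0_left add_cancel_right_right)
  have "\<phi> 1 \<noteq> 0"
    using injD[OF inj, of 1 0] zero by auto
  then have "\<phi> 1 = 1"
    using mult[of 1 1] by simp
  then have of_nat: "\<phi> (of_nat m) = of_nat m" for m
    by (induction m) (simp_all add: add zero)
  have "CHAR('a) dvd m \<longleftrightarrow> CHAR('b) dvd m" for m
    using inj_eq[OF inj, of "of_nat m" 0] by (simp add: of_nat zero flip: of_nat_eq_0_iff_char_dvd)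
  then show ?thesis by (metis dvd_antisym dvd_refl)
qed

lemma CHAR_real_or_complex: "CHAR('k::real_or_complex) = 0"
  using real_or_complex[where 'a = 'k]
  by (elim disjE exE conjE; metis CHAR_eq_if_inj_ring_hom bij_is_inj CHAR_eq_0)

context lie_module
begin

sublocale act_left: Vector_Spaces.linear scale scaleV "\<lambda>x. act x v" for v
  by (rule act_linear_left)

sublocale act_right: Vector_Spaces.linear scaleV scaleV "\<lambda>v. act x v" for x
  by (rule act_linear_right)

end

context graded_thread_module
begin

lemma act_commutator_e:
  assumes "i \<ge> 1" "j \<ge> 1"
  shows "act (e i) (act (e j) v) - act (e j) (act (e i) v)
    = scaleV (of_int (int j - int i)) (act (e (i + j)) v)"
  using act_bracket[of "e i" "e j" v] by (simp add: bracket_e[OF assms] act_left.scale)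

lemma act_e_f_eq_scaleE:
  assumes "i \<ge> 1" "j \<ge> 1"
  obtains c where "act (e i) (f j) = scaleV c (f (i + j))"
proof (cases "j \<le> n + 1")
  case True
  with e_f[OF assms] that show ?thesis
    unfolding V.span_singleton by auto
next
  case False
  with f_zero[of j] that[of 0] show ?thesis by simp
qed

lemma act_act_e_f_neq_zeroD:
  assumes "i \<ge> 1" "j \<ge> 1" "act x (act (e i) (f j)) \<noteq> 0"
  shows "act (e i) (f j) \<noteq> 0" and "act x (f (i + j)) \<noteq> 0"
proof -
  obtain c where "act (e i) (f j) = scaleV c (f (i + j))"
    using act_e_f_eq_scaleE assms(1,2) .
  with assms(3) show "act (e i) (f j) \<noteq> 0" and "act x (f (i + j)) \<noteq> 0"
    by (auto simp: act_right.scale)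
qed

lemma act_e_Suc_neq_zero_cases:
  assumes "CHAR('k) = 0" "k \<ge> 2" "j \<ge> 1" "act (e (Suc k)) (f j) \<noteq> 0"
  obtains (e1_last) "act (e k) (f j) \<noteq> 0" "act (e 1) (f (j + k)) \<noteq> 0"
    | (e1_first) "act (e 1) (f j) \<noteq> 0" "act (e k) (f (Suc j)) \<noteq> 0"
proof -
  have "(of_nat (k - 1) :: 'k) \<noteq> 0"
    using assms(1,2) by (simp add: of_nat_eq_0_iff_char_dvd del: of_nat_diff)
  then have "act (e 1) (act (e k) (f j)) - act (e k) (act (e 1) (f j)) \<noteq> 0"
    using act_commutator_e[of 1 k "f j"] assms(2,4) by simp
  then consider (last) "act (e 1) (act (e k) (f j)) \<noteq> 0"
    | (first) "act (e k) (act (e 1) (f j)) \<noteq> 0"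
    by force
  then show thesis
  proof cases
    case last
    with act_act_e_f_neq_zeroD[of k j "e 1"] assms(2,3) e1_last show thesis
      by (simp add: add.commute)
  next
    case first
    with act_act_e_f_neq_zeroD[of 1 j "e k"] assms(3) e1_first show thesis
      by simp
  qed
qed

lemma e1_zeros_subset_neighbours:
  assumes "CHAR('k) = 0" "j \<ge> 1" "act (e k) (f j) \<noteq> 0"
  shows "\<exists>b. {i \<in> {j..<j + k}. act (e 1) (f i) = 0} \<subseteq> {b, Suc b}"
  using assms(2-)
proof (induction k arbitrary: j)
  case 0
  show ?case by simp
next
  case (Suc k)
  show ?case
  proof (cases "k \<ge> 2")
    case False
    then show ?thesis by (intro exI[of _ j]) auto
  next
    case True
    from assms(1) True Suc.prems show ?thesis
    proof (cases rule: act_e_Suc_neq_zero_cases)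
      case e1_last
      have "{i \<in> {j..<j + Suc k}. act (e 1) (f i) = 0}
          = {i \<in> {j..<j + k}. act (e 1) (f i) = 0}"
        using e1_last(2) by (auto simp: less_Suc_eq)
      with Suc.IH[OF Suc.prems(1) e1_last(1)] show ?thesis by simp
    next
      case e1_first
      have "{i \<in> {j..<j + Suc k}. act (e 1) (f i) = 0}
          = {i \<in> {Suc j..<Suc j + k}. act (e 1) (f i) = 0}"
        using e1_first(1) by (auto simp: Suc_le_eq le_less)
      with Suc.IH[OF _ e1_first(2)] show ?thesis by simp
    qed
  qed
qed

end

theorem corollary2p3:
  fixes scale :: "'k::real_or_complex \<Rightarrow> 'g::ab_group_add \<Rightarrow> 'g"
    and bracket :: "'g \<Rightarrow> 'g \<Rightarrow> 'g"
    and e :: "nat \<Rightarrow> 'g"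
    and scaleV :: "'k \<Rightarrow> 'v::ab_group_add \<Rightarrow> 'v"
    and act :: "'g \<Rightarrow> 'v \<Rightarrow> 'v"
    and n :: nat
    and f :: "nat \<Rightarrow> 'v"
    and \<alpha> :: "nat \<Rightarrow> 'k"
  assumes "n \<ge> 1"
    and "graded_thread_module scale bracket e scaleV act n f"
    and "act (e n) (f 1) \<noteq> 0"
    and "\<And>i. i \<in> {1..n} \<Longrightarrow> act (e 1) (f i) = scaleV (\<alpha> i) (f (i + 1))"
  shows "(\<forall>i\<in>{1..n}. \<alpha> i \<noteq> 0)
    \<or> (\<exists>!k. k \<in> {1..n} \<and> \<alpha> k = 0)
    \<or> (\<exists>k\<in>{1..n - 1}. \<alpha> k = 0 \<and> \<alpha> (k + 1) = 0 \<and>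
         (\<forall>i\<in>{1..n}. i \<noteq> k \<and> i \<noteq> k + 1 \<longrightarrow> \<alpha> i \<noteq> 0))"
proof -
  interpret graded_thread_module scale bracket e scaleV act n f by fact
  define zeros where "zeros = {i \<in> {1..n}. \<alpha> i = 0}"
  obtain b where "{i \<in> {1..<1 + n}. act (e 1) (f i) = 0} \<subseteq> {b, Suc b}"
    using e1_zeros_subset_neighbours[OF CHAR_real_or_complex order.refl assms(3)] ..
  then have "zeros \<subseteq> {b, Suc b}"
    using assms(4) by (auto simp: zeros_def)
  then consider (none) "zeros = {}" | (one) k where "zeros = {k}"
    | (two) k where "zeros = {k, Suc k}"
    by blast
  then show ?thesis
  proof cases
    case none
    then show ?thesis by (auto simp: zeros_def)
  next
    case (one k)
    then have "\<exists>!k. k \<in> zeros" by simp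
    then show ?thesis by (simp add: zeros_def)
  next
    case (two k)
    then have "k \<in> zeros" "Suc k \<in> zeros" by simp_all
    moreover have "\<alpha> i \<noteq> 0" if "i \<in> {1..n}" "i \<noteq> k" "i \<noteq> Suc k" for i
      using two that by (auto simp: zeros_def)
    ultimately show ?thesis by (intro disjI2 bexI[of _ k]) (auto simp: zeros_def)
  qed
qed

end
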